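(* For any summable weighted graph $(G,m)$ without isolated vertices one has $\kappa(G,m)\ge 0$. Moreover, $\kappa(G,m)=0$ if and only if the graph $G$ is bipartite.
   Context: A weighted graph $(G,m)$ consists of a countable simple graph $G$ with vertex set $V(G)$ and a function $m:E(G)\to(0,\infty)$; it is summable if $\sum_{e\in E(G)}m(e)<\infty$. Write $m(vw)=m(\{v,w\})$ if $\{v,w\}\in E(G)$ and $m(vw)=0$ otherwise; $m(v)=\sum_w m(vw)>0$. For $v\in V(G)$ and $S\subset V(G)$ put $p_S(v)=\frac{1}{m(v)}\sum_{w\in S}m(vw)$. For a partition $V(G)=A\sqcup B$ into two nonempty sets, $\kappa(A,B)=\max\{\sup_{v\in A}p_A(v),\sup_{w\in B}p_B(w)\}$, and $\kappa(G,m)=\inf\kappa(A,B)$ over all such partitions. *)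

theory Defs
  imports "HOL-Analysis.Infinite_Sum" "HOL-Library.Ramsey"
begin

text \<open>
  Edges are two-element subsets of the vertex set, so the graph is simple. The vertex set is
  nonempty (as \<open>kappa\<close> below is an infimum over partitions into two nonempty sets,
  it has no meaning for the graph without vertices); it may be finite or countably infinite.
\<close>

locale weighted_graph =
  fixes V :: "'a set" and E :: "'a set set" and m :: "'a set \<Rightarrow> real"
  assumes countable_verts: "countable V"
    and verts_nonempty: "V \<noteq> {}"
    and edges: "E \<subseteq> [V]\<^bsup>2\<^esup>"
    and weight_pos: "\<And>e. e \<in> E \<Longrightarrow> m e > 0"

definition summable_weight :: "'a set set \<Rightarrow> ('a set \<Rightarrow> real) \<Rightarrow> bool" where
  "summable_weight E m \<longleftrightarrow> m summable_on E"

definition isolated_vertex :: "'a set set \<Rightarrow> 'a \<Rightarrow> bool" where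
  "isolated_vertex E v \<longleftrightarrow> (\<forall>e\<in>E. v \<notin> e)"

definition bipartite_graph :: "'a set \<Rightarrow> 'a set set \<Rightarrow> bool" where
  "bipartite_graph V E \<longleftrightarrow>
     (\<exists>A B. A \<union> B = V \<and> A \<inter> B = {} \<and> (\<forall>e\<in>E. \<exists>a\<in>A. \<exists>b\<in>B. e = {a, b}))"

definition edge_weight :: "'a set set \<Rightarrow> ('a set \<Rightarrow> real) \<Rightarrow> 'a \<Rightarrow> 'a \<Rightarrow> real" where
  "edge_weight E m v w = (if {v, w} \<in> E then m {v, w} else 0)"

definition vertex_weight :: "'a set \<Rightarrow> 'a set set \<Rightarrow> ('a set \<Rightarrow> real) \<Rightarrow> 'a \<Rightarrow> real" where
  "vertex_weight V E m v = (\<Sum>\<^sub>\<infinity>w\<in>V. edge_weight E m v w)"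

definition trans_prob ::
    "'a set \<Rightarrow> 'a set set \<Rightarrow> ('a set \<Rightarrow> real) \<Rightarrow> 'a set \<Rightarrow> 'a \<Rightarrow> real" where
  "trans_prob V E m S v = (1 / vertex_weight V E m v) * (\<Sum>\<^sub>\<infinity>w\<in>S. edge_weight E m v w)"

definition bipartitions :: "'a set \<Rightarrow> ('a set \<times> 'a set) set" where
  "bipartitions V = {(A, B). A \<union> B = V \<and> A \<inter> B = {} \<and> A \<noteq> {} \<and> B \<noteq> {}}"

text \<open>
  The suprema and the infimum are taken in the reals: for a summable weighted graph
  all values of \<open>trans_prob\<close> at subsets of \<open>V\<close> lie in \<open>[0, 1]\<close>,
  and without isolated vertices \<open>V\<close> has at least two elements, so that the
  infimum is over a nonempty set.
\<close>

definition kappa_partition ::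
    "'a set \<Rightarrow> 'a set set \<Rightarrow> ('a set \<Rightarrow> real) \<Rightarrow> 'a set \<Rightarrow> 'a set \<Rightarrow> real" where
  "kappa_partition V E m A B =
     max (SUP v\<in>A. trans_prob V E m A v) (SUP w\<in>B. trans_prob V E m B w)"

definition kappa :: "'a set \<Rightarrow> 'a set set \<Rightarrow> ('a set \<Rightarrow> real) \<Rightarrow> real" where
  "kappa V E m = (INF (A, B)\<in>bipartitions V. kappa_partition V E m A B)"

end

theory Submission
  imports Defs
begin

text \<open>
  Every transition probability lies in \<open>[0, 1]\<close>, which gives \<open>kappa \<ge> 0\<close>, and a bipartition of the
  graph has \<open>kappa_partition = 0\<close>. For the converse, if \<open>kappa = 0\<close>, choose partitions \<open>(P n, Q n)\<close>
  with \<open>kappa_partition < 1 / (n + 1)\<close>. An edge inside a part contributes a fixed positive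
  transition probability, so every given edge is split by all but finitely many of these partitions.
  Hence, along a path from a root of its connected component, the side of a vertex relative to the
  root is eventually constant in \<open>n\<close>; the limiting sides form a bipartition of the graph.
\<close>

text \<open>Membership of a vertex in \<open>X n\<close> need not settle, since the two sides may be
  swapped as \<open>n\<close> varies. Its agreement with a fixed vertex of the same component does
  settle: a path is finite, and each of its steps eventually flips the side.\<close>

lemma eventually_alternating_two_colouring:
  fixes R :: "'a \<Rightarrow> 'a \<Rightarrow> bool" and X :: "'i \<Rightarrow> 'a set" and F :: "'i filter"
  assumes "F \<noteq> bot"
    and sym: "\<And>v w. R v w \<Longrightarrow> R w v"
    and split: "\<And>v w. R v w \<Longrightarrow> \<forall>\<^sub>F n in F. (v \<in> X n) \<noteq> (w \<in> X n)"
  shows "\<exists>A. \<forall>v w. R v w \<longrightarrow> (v \<in> A) \<noteq> (w \<in> A)"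
proof -
  \<comment> \<open>The choice depends on \<open>v\<close> only through the set of vertices
    reachable from it, so vertices of one component share a root.\<close>
  define root where "root v = (SOME r. R\<^sup>*\<^sup>* v r)" for v
  define A where "A = {v. \<forall>\<^sub>F n in F. (v \<in> X n) = (root v \<in> X n)}"
  have const: "(\<forall>\<^sub>F n in F. (v \<in> X n) = (r \<in> X n)) \<or> (\<forall>\<^sub>F n in F. (v \<in> X n) \<noteq> (r \<in> X n))"
    if "R\<^sup>*\<^sup>* v r" for v r
    using that
  proof (induction rule: rtranclp_induct)
    case base
    show ?case by simp
  next
    case (step y z)
    note yz = split[OF step.hyps(2)]
    from step.IH show ?case
    proof
      assume "\<forall>\<^sub>F n in F. (v \<in> X n) = (y \<in> X n)"
      with yz have "\<forall>\<^sub>F n in F. (v \<in> X n) \<noteq> (z \<in> X n)"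
        by eventually_elim blast
      then show ?case ..
    next
      assume "\<forall>\<^sub>F n in F. (v \<in> X n) \<noteq> (y \<in> X n)"
      with yz have "\<forall>\<^sub>F n in F. (v \<in> X n) = (z \<in> X n)"
        by eventually_elim blast
      then show ?case ..
    qed
  qed
  have reach: "R\<^sup>*\<^sup>* v (root v)" for v
    unfolding root_def by (rule someI[of _ v]) simp
  have "(v \<in> A) \<noteq> (w \<in> A)" if "R v w" for v w
  proof -
    have "R\<^sup>*\<^sup>* v = R\<^sup>*\<^sup>* w"
      using that sym by (intro ext) (meson converse_rtranclp_into_rtranclp)
    then have root: "root w = root v"
      by (simp add: root_def)
    have vw: "\<forall>\<^sub>F n in F. (v \<in> X n) \<noteq> (w \<in> X n)"
      by (rule split[OF that])
    show ?thesis
    proof (cases "v \<in> A")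
      case True
      then have v: "\<forall>\<^sub>F n in F. (v \<in> X n) = (root v \<in> X n)"
        by (simp add: A_def)
      have "w \<notin> A"
      proof
        assume "w \<in> A"
        then have "\<forall>\<^sub>F n in F. (w \<in> X n) = (root v \<in> X n)"
          by (simp add: A_def root)
        with v vw have "\<forall>\<^sub>F n in F. False"
          by eventually_elim blast
        with \<open>F \<noteq> bot\<close> show False by simp
      qed
      with True show ?thesis by simp
    next
      case False
      \<comment> \<open>\<open>v \<notin> A\<close> only denies eventual agreement with the root;
        the dichotomy \<open>const\<close> turns this into eventual disagreement.\<close>
      then have "\<forall>\<^sub>F n in F. (v \<in> X n) \<noteq> (root v \<in> X n)"
        using const[OF reach] by (auto simp: A_def)
      with vw have "\<forall>\<^sub>F n in F. (w \<in> X n) = (root v \<in> X n)"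
        by eventually_elim blast
      then show ?thesis
        using False by (simp add: A_def root)
    qed
  qed
  then show ?thesis by blast
qed

lemma bipartitions_sym: "(A, B) \<in> bipartitions V \<Longrightarrow> (B, A) \<in> bipartitions V"
  by (auto simp: bipartitions_def)

lemma kappa_partition_sym: "kappa_partition V E m A B = kappa_partition V E m B A"
  by (simp add: kappa_partition_def max.commute)

section \<open>Vertex weights and transition probabilities\<close>

locale summable_weighted_graph = weighted_graph V E m
  for V :: "'a set" and E :: "'a set set" and m :: "'a set \<Rightarrow> real" +
  assumes summable: "m summable_on E"
    and no_isolated: "\<And>v. v \<in> V \<Longrightarrow> \<not> isolated_vertex E v"
begin

lemma edgeE:
  assumes "e \<in> E"
  obtains v w where "e = {v, w}" "v \<in> V" "w \<in> V" "v \<noteq> w"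
  using assms edges nsets2_E by blast

lemma edge_verts: "{v, w} \<in> E \<Longrightarrow> v \<in> V \<and> w \<in> V \<and> v \<noteq> w"
  by (erule edgeE) (auto simp: doubleton_eq_iff)

lemma neighbour:
  assumes "v \<in> V"
  obtains w where "{v, w} \<in> E"
proof -
  from no_isolated[OF assms] obtain e where "e \<in> E" "v \<in> e"
    by (auto simp: isolated_vertex_def)
  obtain x y where "e = {x, y}"
    using edgeE[OF \<open>e \<in> E\<close>] by blast
  then have "e = {v, if v = x then y else x}"
    using \<open>v \<in> e\<close> by auto
  with \<open>e \<in> E\<close> show ?thesis
    using that by metis
qed

lemma edge_weight_nonneg: "edge_weight E m v w \<ge> 0"
  using weight_pos by (auto simp: edge_weight_def intro: less_imp_le)

text \<open>The map sending \<open>w\<close> to \<open>{v, w}\<close> is injective, so the nonzero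
  weights at \<open>v\<close> form a subfamily of the summable family \<open>m\<close> on
  \<open>E\<close>; all other terms vanish.\<close>

lemma edge_weight_summable: "edge_weight E m v summable_on V"
proof -
  let ?N = "{w \<in> V. {v, w} \<in> E}"
  have inj: "inj_on (\<lambda>w. {v, w}) ?N"
    by (auto simp: inj_on_def doubleton_eq_iff)
  have "m summable_on (\<lambda>w. {v, w}) ` ?N"
    by (rule summable_on_subset_banach[OF summable]) auto
  then have "(\<lambda>w. m {v, w}) summable_on ?N"
    unfolding summable_on_reindex[OF inj] o_def .
  then show ?thesis
    by (rule summable_on_cong_neutral[THEN iffD1, rotated -1]) (auto simp: edge_weight_def)
qed

lemma edge_weight_summable_subset: "S \<subseteq> V \<Longrightarrow> edge_weight E m v summable_on S"
  by (rule summable_on_subset_banach[OF edge_weight_summable])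

lemma infsum_edge_weight_mono:
  assumes "S \<subseteq> T" "T \<subseteq> V"
  shows "infsum (edge_weight E m v) S \<le> infsum (edge_weight E m v) T"
  using assms by (intro infsum_mono2 edge_weight_summable_subset) (auto simp: edge_weight_nonneg)

lemma edge_weight_le_infsum:
  assumes "w \<in> S" "S \<subseteq> V"
  shows "edge_weight E m v w \<le> infsum (edge_weight E m v) S"
  using infsum_edge_weight_mono[of "{w}" S v] assms by simp

text \<open>Some edge at \<open>v\<close> already contributes a positive term. Hence the division in
  \<open>trans_prob\<close> is never by zero.\<close>

lemma vertex_weight_pos:
  assumes "v \<in> V"
  shows "vertex_weight V E m v > 0"
proof -
  obtain w where w: "{v, w} \<in> E"
    using neighbour[OF assms] .
  then have "0 < edge_weight E m v w"
    by (simp add: edge_weight_def weight_pos)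
  also have "\<dots> \<le> vertex_weight V E m v"
    unfolding vertex_weight_def using edge_verts[OF w] by (intro edge_weight_le_infsum) auto
  finally show ?thesis .
qed

lemma trans_prob_nonneg: "v \<in> V \<Longrightarrow> trans_prob V E m S v \<ge> 0"
  using vertex_weight_pos[of v]
  by (simp add: trans_prob_def infsum_nonneg edge_weight_nonneg)

lemma trans_prob_le_1:
  assumes "v \<in> V" "S \<subseteq> V"
  shows "trans_prob V E m S v \<le> 1"
  using vertex_weight_pos[OF assms(1)] infsum_edge_weight_mono[OF assms(2) order_refl, of v]
  by (simp add: trans_prob_def vertex_weight_def)

lemma bdd_above_trans_prob: "S \<subseteq> V \<Longrightarrow> bdd_above (trans_prob V E m S ` S)"
  by (rule bdd_aboveI[of _ 1]) (auto intro!: trans_prob_le_1)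

section \<open>Bounds for \<open>kappa_partition\<close> and \<open>kappa\<close>\<close>

lemma trans_prob_le_kappa_partition:
  assumes "(A, B) \<in> bipartitions V" "v \<in> A"
  shows "trans_prob V E m A v \<le> kappa_partition V E m A B"
proof -
  have "A \<subseteq> V"
    using assms(1) by (auto simp: bipartitions_def)
  then have "trans_prob V E m A v \<le> (SUP v\<in>A. trans_prob V E m A v)"
    by (intro cSUP_upper assms bdd_above_trans_prob)
  then show ?thesis
    by (simp add: kappa_partition_def)
qed

lemma kappa_partition_nonneg:
  assumes "(A, B) \<in> bipartitions V"
  shows "kappa_partition V E m A B \<ge> 0"
proof -
  obtain v where "v \<in> A" "v \<in> V"
    using assms by (auto simp: bipartitions_def)
  then show ?thesis
    using trans_prob_le_kappa_partition[OF assms] trans_prob_nonneg order_trans by blast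
qed

lemma edge_in_part_le_kappa_partition:
  assumes "(A, B) \<in> bipartitions V" "{v, w} \<in> E" "v \<in> A" "w \<in> A"
  shows "m {v, w} / vertex_weight V E m v \<le> kappa_partition V E m A B"
proof -
  have AV: "A \<subseteq> V"
    using assms(1) by (auto simp: bipartitions_def)
  have "m {v, w} \<le> infsum (edge_weight E m v) A"
    using edge_weight_le_infsum[OF assms(4) AV, of v] assms(2) by (simp add: edge_weight_def)
  then have "m {v, w} / vertex_weight V E m v \<le> trans_prob V E m A v"
    using vertex_weight_pos[of v] AV assms(3) by (auto simp: trans_prob_def divide_simps)
  also have "\<dots> \<le> kappa_partition V E m A B"
    by (rule trans_prob_le_kappa_partition[OF assms(1,3)])
  finally show ?thesis .
qed

text \<open>Both ends lie in \<open>A\<close> or both in its complement \<open>B\<close>, and the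
  two cases are exchanged by symmetry. The lower bound does not depend on the partition, so
  partitions with small enough value must split the edge.\<close>

lemma unsplit_edge_le_kappa_partition:
  assumes "(A, B) \<in> bipartitions V" "{v, w} \<in> E" "(v \<in> A) = (w \<in> A)"
  shows "m {v, w} / vertex_weight V E m v \<le> kappa_partition V E m A B"
proof (cases "v \<in> A")
  case True
  then show ?thesis
    using assms by (auto intro!: edge_in_part_le_kappa_partition)
next
  case False
  then have "v \<in> B" "w \<in> B"
    using assms edge_verts[OF assms(2)] by (auto simp: bipartitions_def)
  then show ?thesis
    using edge_in_part_le_kappa_partition[OF bipartitions_sym[OF assms(1)] assms(2)]
    by (simp add: kappa_partition_sym)
qed

text \<open>A vertex has a neighbour different from itself, so it can be separated from the rest.
  This makes the real infimum in \<open>kappa\<close> meaningful.\<close>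

lemma bipartitions_nonempty: "bipartitions V \<noteq> {}"
proof -
  obtain v where v: "v \<in> V"
    using verts_nonempty by blast
  obtain w where "{v, w} \<in> E"
    using neighbour[OF v] .
  then have "({v}, V - {v}) \<in> bipartitions V"
    using v edge_verts[of v w] by (auto simp: bipartitions_def)
  then show ?thesis by blast
qed

lemma kappa_nonneg: "kappa V E m \<ge> 0"
  unfolding kappa_def
  by (rule cINF_greatest[OF bipartitions_nonempty]) (auto intro: kappa_partition_nonneg)

lemma kappa_le_kappa_partition:
  assumes "(A, B) \<in> bipartitions V"
  shows "kappa V E m \<le> kappa_partition V E m A B"
proof -
  have "bdd_below ((\<lambda>(A, B). kappa_partition V E m A B) ` bipartitions V)"
    by (rule bdd_belowI[of _ 0]) (auto intro: kappa_partition_nonneg)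
  from cINF_lower[OF this assms] show ?thesis
    by (simp add: kappa_def)
qed

section \<open>The two directions of the equivalence\<close>

lemma kappa_eq_0_if_bipartite:
  assumes "bipartite_graph V E"
  shows "kappa V E m = 0"
proof -
  obtain A B where AB: "A \<union> B = V" "A \<inter> B = {}"
    and split: "\<forall>e\<in>E. \<exists>a\<in>A. \<exists>b\<in>B. e = {a, b}"
    using assms unfolding bipartite_graph_def by (elim exE conjE)
  obtain v where "v \<in> V"
    using verts_nonempty by blast
  then obtain w where "{v, w} \<in> E"
    by (rule neighbour)
  \<comment> \<open>\<open>bipartite_graph\<close> allows empty parts, but an existing edge has an
    end in each.\<close>
  then have ne: "A \<noteq> {}" "B \<noteq> {}"
    using split by auto
  then have part: "(A, B) \<in> bipartitions V"
    using AB by (simp add: bipartitions_def)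
  have zero: "trans_prob V E m S v = 0" if "S = A \<or> S = B" "v \<in> S" for S v
  proof -
    have "edge_weight E m v w = 0" if "w \<in> S" for w
    proof -
      have "{v, w} \<notin> E"
      proof
        assume "{v, w} \<in> E"
        then obtain a b where "a \<in> A" "b \<in> B" "{v, w} = {a, b}"
          using split by meson
        then show False
          using \<open>S = A \<or> S = B\<close> \<open>v \<in> S\<close> \<open>w \<in> S\<close> AB(2) by (auto simp: doubleton_eq_iff)
      qed
      then show ?thesis
        by (simp add: edge_weight_def)
    qed
    then show ?thesis
      by (simp add: trans_prob_def infsum_0)
  qed
  have "kappa_partition V E m A B = 0"
    using ne by (simp add: kappa_partition_def zero)
  then show ?thesis
    using kappa_le_kappa_partition[OF part] kappa_nonneg by simp
qed

lemma bipartite_if_kappa_eq_0: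
  assumes "kappa V E m = 0"
  shows "bipartite_graph V E"
proof -
  \<comment> \<open>Otherwise \<open>inverse (real (Suc n))\<close> would be a positive lower bound
    for the infimum. \<open>Suc\<close> matters at \<open>n = 0\<close>, because
    \<open>inverse 0 = 0\<close>.\<close>
  have "\<exists>P Q. (P, Q) \<in> bipartitions V \<and> kappa_partition V E m P Q < inverse (real (Suc n))" for n
  proof (rule ccontr)
    assume "\<not> ?thesis"
    then have "inverse (real (Suc n)) \<le> kappa V E m"
      unfolding kappa_def
      by (intro cINF_greatest[OF bipartitions_nonempty]) (auto simp: not_less)
    with assms show False
      by (simp add: field_simps)
  qed
  then obtain P Q where PQ: "\<And>n. (P n, Q n) \<in> bipartitions V"
    and small: "\<And>n. kappa_partition V E m (P n) (Q n) < inverse (real (Suc n))"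
    by metis
  have "\<forall>\<^sub>F n in sequentially. (v \<in> P n) \<noteq> (w \<in> P n)" if e: "{v, w} \<in> E" for v w
  proof -
    have "0 < m {v, w} / vertex_weight V E m v"
      using e edge_verts[OF e] weight_pos vertex_weight_pos by simp
    then have "\<forall>\<^sub>F n in sequentially. inverse (real (Suc n)) < m {v, w} / vertex_weight V E m v"
      by (rule order_tendstoD(2)[OF LIMSEQ_inverse_real_of_nat])
    then show ?thesis
    proof eventually_elim
      case (elim n)
      then show ?case
        using unsplit_edge_le_kappa_partition[OF PQ e, of n] small[of n] by auto
    qed
  qed
  \<comment> \<open>The relation is adjacency, symmetric because \<open>{v, w} = {w, v}\<close>, and
    the sets are the first parts \<open>P n\<close>.\<close>
  then have "\<exists>A. \<forall>v w. {v, w} \<in> E \<longrightarrow> (v \<in> A) \<noteq> (w \<in> A)"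
    by (intro eventually_alternating_two_colouring[of sequentially _ P])
      (simp_all add: insert_commute)
  then obtain A where A: "\<And>v w. {v, w} \<in> E \<Longrightarrow> (v \<in> A) \<noteq> (w \<in> A)"
    by blast
  \<comment> \<open>The colouring \<open>A\<close> lives on the whole type, so it is cut down to
    \<open>V\<close>.\<close>
  have "\<exists>a\<in>V \<inter> A. \<exists>b\<in>V - A. e = {a, b}" if "e \<in> E" for e
  proof -
    obtain v w where e: "e = {v, w}" "v \<in> V" "w \<in> V"
      using edgeE[OF \<open>e \<in> E\<close>] by metis
    show ?thesis
      using A[of v w] e that by (cases "v \<in> A") (auto simp: doubleton_eq_iff)
  qed
  then show ?thesis
    unfolding bipartite_graph_def
    by (intro exI[of _ "V \<inter> A"] exI[of _ "V - A"]) auto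
qed

end

theorem theorem6p2:
  fixes V :: "'a set" and E :: "'a set set" and m :: "'a set \<Rightarrow> real"
  assumes "weighted_graph V E m"
    and "summable_weight E m"
    and "\<And>v. v \<in> V \<Longrightarrow> \<not> isolated_vertex E v"
  shows "kappa V E m \<ge> 0 \<and> (kappa V E m = 0 \<longleftrightarrow> bipartite_graph V E)"
proof -
  interpret summable_weighted_graph V E m
    using assms
    by (simp add: summable_weighted_graph_def summable_weighted_graph_axioms_def summable_weight_def)
  show ?thesis
    using kappa_nonneg kappa_eq_0_if_bipartite bipartite_if_kappa_eq_0 by blast
qed

end
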